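(* Let $a$ be an integer with $a\notin\{0,1,-1\}$, let $m$ be an odd positive integer, and write $G_{\frac{m-1}{2}}(x)=\sum_{s=0}^{m-1}b_sx^s$, where $G_N(x)=\prod_{l=1}^{N}(x-1-a\zeta_{2N+1}^l)(x-1-a\zeta_{2N+1}^{-l})$ with $\zeta_{2N+1}=e^{2\pi i/(2N+1)}$. Then for every integer $r$ and every integer $n\geq1$, $$\sum_{s=0}^{m-1}b_s\Delta_m(r,n+s)=0.$$
   Context: For integers $n>0$, $m>0$, $r$ and $a$, let $\left[\begin{array}{c}n\\ r\end{array}\right]_m(a)=\sum_{0\le k\le n,\ k\equiv r\ (\mathrm{mod}\ m)}\binom nk a^k$. For odd $m$, $\Delta_m(r,n)=m\left[\begin{array}{c}n\\ r\end{array}\right]_m(a)-(1+a)^n$; for even $m$, $\Delta_m(r,n)=m\left[\begin{array}{c}n\\ r\end{array}\right]_m(a)-(1+a)^n-(-1)^r(1-a)^n$. *)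

theory Defs
  imports Complex_Main "HOL-Computational_Algebra.Polynomial" "HOL-Number_Theory.Cong"
begin

definition bracket :: "nat \<Rightarrow> int \<Rightarrow> nat \<Rightarrow> int \<Rightarrow> int" where
  "bracket n r m a = (\<Sum>k | k \<le> n \<and> [int k = r] (mod int m). int (n choose k) * a ^ k)"

text \<open>The conditional in the even case is \<open>(-1)\<^sup>r\<close> for a possibly negative integer \<open>r\<close>.\<close>

definition Delta :: "int \<Rightarrow> nat \<Rightarrow> int \<Rightarrow> nat \<Rightarrow> int" where
  "Delta a m r n =
     (if odd m then int m * bracket n r m a - (1 + a) ^ n
      else int m * bracket n r m a - (1 + a) ^ n - (if even r then 1 else -1) * (1 - a) ^ n)"

definition zeta :: "nat \<Rightarrow> complex" where
  "zeta m = exp (2 * of_real pi * \<i> / of_nat m)"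

definition G :: "int \<Rightarrow> nat \<Rightarrow> complex poly" where
  "G a N = (\<Prod>l = 1..N. [:- 1 - of_int a * zeta (2 * N + 1) ^ l, 1:]
                        * [:- 1 - of_int a * zeta (2 * N + 1) powi (- int l), 1:])"

lemma degree_G: "degree (G a N) = 2 * N"
proof -
  have "degree (G a N) = (\<Sum>l = 1..N. degree ([:- 1 - of_int a * zeta (2 * N + 1) ^ l, 1:]
                        * [:- 1 - of_int a * zeta (2 * N + 1) powi (- int l), 1:]))"
    unfolding G_def by (rule degree_prod_eq_sum_degree) auto
  also have "\<dots> = (\<Sum>l = 1..N. 2)"
    by (intro sum.cong refl, subst degree_mult_eq) auto
  finally show ?thesis by simp
qed

lemma poly_G_expansion:
  assumes "odd m"
  shows "poly (G a ((m - 1) div 2)) x = (\<Sum>s = 0..m - 1. coeff (G a ((m - 1) div 2)) s * x ^ s)"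
proof -
  have "degree (G a ((m - 1) div 2)) = m - 1"
    using assms by (simp add: degree_G)
  then show ?thesis
    by (simp add: poly_altdef atLeast0AtMost)
qed

end

theory Submission
  imports Defs
begin

text \<open>
  With \<open>\<zeta> = zeta m\<close>, the roots-of-unity filter gives
  \<open>m [n, r]\<^sub>m(a) = (\<Sum>j<m. \<zeta>\<^bsup>-jr\<^esup> (1 + a \<zeta>\<^bsup>j\<^esup>)\<^bsup>n\<^esup>)\<close>. For odd \<open>m\<close>, subtracting
  \<open>(1 + a)\<^bsup>n\<^esup>\<close> removes the term \<open>j = 0\<close>, so \<open>\<Delta>\<^sub>m(r, n)\<close> is a linear combination of the
  geometric sequences with ratios \<open>1 + a \<zeta>\<^bsup>j\<^esup>\<close>, \<open>0 < j < m\<close>. All these ratios are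
  roots of \<open>G\<close>, which is therefore a characteristic polynomial of the sequence.
\<close>

lemma zeta_powi: "zeta m powi d = cis (2 * pi * of_int d / of_nat m)"
proof -
  have "zeta m = cis (2 * pi / of_nat m)"
    by (simp add: zeta_def cis_conv_exp mult_ac)
  then show ?thesis
    by (simp add: cis_power_int mult_ac)
qed

lemma zeta_nonzero: "zeta m \<noteq> 0"
  by (simp add: zeta_def)

lemma zeta_powi_eq_1_iff:
  assumes "m > 0"
  shows "zeta m powi d = 1 \<longleftrightarrow> int m dvd d"
proof
  assume "zeta m powi d = 1"
  \<comment> \<open>The real part alone suffices: the cosine is 1 only at integer multiples of
    \<open>2 * pi\<close>.\<close>
  then have "cos (2 * pi * of_int d / of_nat m) = 1"
    by (metis zeta_powi cis.sel(1) one_complex.sel(1))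
  then obtain q :: int where "2 * pi * of_int d / of_nat m = of_int q * 2 * pi"
    unfolding cos_one_2pi_int by blast
  then have "real_of_int d = of_int (int m * q)"
    using assms by (simp add: field_simps)
  then show "int m dvd d"
    unfolding of_int_eq_iff by simp
next
  assume "int m dvd d"
  then obtain q where "d = int m * q" ..
  then show "zeta m powi d = 1"
    using assms cis_multiple_2pi[of "of_int q"] by (simp add: zeta_powi mult.assoc)
qed

text \<open>Orthogonality of characters: the ratio is an \<open>m\<close>-th root of unity, so if it
  is not 1, the numerator of the geometric sum vanishes.\<close>

lemma sum_zeta_powi:
  assumes "m > 0"
  shows "(\<Sum>j<m. (zeta m powi d) ^ j) = (if int m dvd d then of_nat m else 0)"
proof (cases "int m dvd d")
  case True
  then have "zeta m powi d = 1"
    using assms by (simp add: zeta_powi_eq_1_iff)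
  with True show ?thesis by simp
next
  case False
  have "(zeta m powi d) ^ m = zeta m powi (d * int m)"
    by (simp add: power_int_mult)
  also have "\<dots> = 1"
    using assms by (simp add: zeta_powi_eq_1_iff)
  finally show ?thesis
    using False assms by (simp add: zeta_powi_eq_1_iff geometric_sum)
qed

text \<open>Expanding the binomial and swapping the sums leaves, for each \<open>k\<close>, a
  character sum over \<open>j\<close> that selects exactly the \<open>k\<close> congruent to
  \<open>r\<close>.\<close>

lemma bracket_roots_of_unity_filter:
  assumes "m > 0"
  shows "of_nat m * of_int (bracket n r m a)
         = (\<Sum>j<m. (zeta m powi (- r)) ^ j * (1 + of_int a * zeta m ^ j) ^ n)"
proof -
  have *: "(zeta m powi (- r)) ^ j * (zeta m ^ j) ^ k = (zeta m powi (int k - r)) ^ j" for j k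
  proof -
    have "zeta m powi (int k - r) = zeta m powi (- r) * zeta m ^ k"
      using power_int_add[of "zeta m" "- r" "int k"] by (simp add: zeta_nonzero)
    then show ?thesis
      by (simp add: power_mult_distrib flip: power_mult) (simp add: mult.commute)
  qed
  have "(\<Sum>j<m. (zeta m powi (- r)) ^ j * (1 + of_int a * zeta m ^ j) ^ n)
        = (\<Sum>j<m. \<Sum>k\<le>n. of_nat (n choose k) * of_int a ^ k
             * ((zeta m powi (- r)) ^ j * (zeta m ^ j) ^ k))"
    by (simp add: binomial_ring[of "of_int a * _" 1] add.commute[of 1] sum_distrib_left
        power_mult_distrib mult_ac)
  also have "\<dots> = (\<Sum>k\<le>n. of_nat (n choose k) * of_int a ^ k
                     * (\<Sum>j<m. (zeta m powi (int k - r)) ^ j))"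
    unfolding * by (subst sum.swap) (simp add: sum_distrib_left)
  also have "\<dots> = (\<Sum>k\<le>n. if [int k = r] (mod int m)
                     then of_nat m * (of_nat (n choose k) * of_int a ^ k) else 0)"
    using assms by (intro sum.cong refl) (simp add: sum_zeta_powi cong_iff_dvd_diff)
  also have "\<dots> = (\<Sum>k | k \<le> n \<and> [int k = r] (mod int m).
                     of_nat m * (of_nat (n choose k) * of_int a ^ k))"
    by (subst sum.inter_filter[symmetric]) simp_all
  finally show ?thesis
    by (simp add: bracket_def sum_distrib_left)
qed

lemma Delta_odd_eq_sum:
  assumes "odd m"
  shows "of_int (Delta a m r n)
         = (\<Sum>j = 1..<m. (zeta m powi (- r)) ^ j * (1 + of_int a * zeta m ^ j) ^ n)"
proof -
  have "m > 0" using assms by (rule odd_pos)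
  then have "{..<m} = insert 0 {1..<m}" by auto
  with bracket_roots_of_unity_filter[OF \<open>m > 0\<close>, of n r a] assms show ?thesis
    by (simp add: Delta_def)
qed

text \<open>The factors of \<open>G\<close> use only the exponents \<open>l\<close> and
  \<open>- l\<close> with \<open>l\<close> in \<open>{1..N}\<close>. Modulo
  \<open>m = 2 * N + 1\<close> these cover all nonzero residues.\<close>

lemma poly_G_root:
  assumes "odd m" "j \<in> {1..<m}"
  shows "poly (G a ((m - 1) div 2)) (1 + of_int a * zeta m ^ j) = 0"
proof -
  define N where "N = (m - 1) div 2"
  have m: "m = 2 * N + 1"
    using assms by (auto simp: N_def elim: oddE)
  have "\<exists>l\<in>{1..N}. zeta m ^ j = zeta m ^ l \<or> zeta m ^ j = zeta m powi (- int l)"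
  proof (cases "j \<le> N")
    case True
    with assms show ?thesis by auto
  next
    case False
    \<comment> \<open>By periodicity, an exponent \<open>j > N\<close> is the same as
      \<open>- (m - j)\<close>, so \<open>l = m - j\<close> serves as witness.\<close>
    have "zeta m powi int m = 1"
      using m by (subst zeta_powi_eq_1_iff) auto
    moreover have "zeta m powi int j = zeta m powi (int m + (- int (m - j)))"
      using assms by simp
    moreover have "\<dots> = zeta m powi int m * zeta m powi (- int (m - j))"
      by (intro power_int_add disjI1 zeta_nonzero)
    ultimately have "zeta m ^ j = zeta m powi (- int (m - j))"
      by (metis mult_1 power_int_of_nat)
    moreover have "m - j \<in> {1..N}"
      using False assms m by auto
    ultimately show ?thesis by blast
  qed
  then obtain l where l: "l \<in> {1..N}"
    and "zeta m ^ j = zeta m ^ l \<or> zeta m ^ j = zeta m powi (- int l)" by blast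
  then have "poly ([:- 1 - of_int a * zeta m ^ l, 1:]
                    * [:- 1 - of_int a * zeta m powi (- int l), 1:]) (1 + of_int a * zeta m ^ j) = 0"
    unfolding poly_mult by auto
  with l show ?thesis
    unfolding N_def[symmetric] G_def m[symmetric] poly_prod by (intro prod_zero) blast+
qed

theorem theorem3p6:
  fixes a r :: int and m n :: nat
  assumes "a \<notin> {0, 1, -1}" and "odd m" and "n \<ge> 1"
  shows "(\<Sum>s = 0..m - 1. coeff (G a ((m - 1) div 2)) s * of_int (Delta a m r (n + s))) = 0"
proof -
  let ?G = "G a ((m - 1) div 2)"
  let ?x = "\<lambda>j. 1 + of_int a * zeta m ^ j"
  have "(\<Sum>s = 0..m - 1. coeff ?G s * of_int (Delta a m r (n + s)))
        = (\<Sum>s = 0..m - 1. \<Sum>j = 1..<m.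
             (zeta m powi (- r)) ^ j * ?x j ^ n * (coeff ?G s * ?x j ^ s))"
    by (simp only: Delta_odd_eq_sum[OF \<open>odd m\<close>] sum_distrib_left power_add mult_ac)
  \<comment> \<open>For fixed \<open>j\<close>, the shift by \<open>s\<close> only contributes
    \<open>?x j ^ s\<close>, so the sum over \<open>s\<close> is the value of \<open>?G\<close> at
    the ratio \<open>?x j\<close>.\<close>
  also have "\<dots> = (\<Sum>j = 1..<m. (zeta m powi (- r)) ^ j * ?x j ^ n * poly ?G (?x j))"
    by (subst sum.swap) (simp only: poly_G_expansion[OF \<open>odd m\<close>] sum_distrib_left)
  also have "\<dots> = 0"
    using poly_G_root[OF \<open>odd m\<close>] by (intro sum.neutral ballI) simp
  finally show ?thesis .
qed

end
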